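(* \[\sum_{k=0}^{\infty}\left(\frac{-1}{4}\right)^k\frac{(1)_k^5}{(\frac{3}{2})_k^5}\left\{(10k^2+14k+5)\Big[8H_{2k+1}^{(3)}-H_{k}^{(3)}\Big]+\frac{2}{k+1}\right\}=\frac{49\,\zeta(3)^2}{2}.\]
   Context: For a number $x$ and a nonnegative integer $m$, the shifted factorial is $(x)_0=1$ and $(x)_m=x(x+1)\cdots(x+m-1)$ for $m\ge 1$; $(x)_k^5$ means $((x)_k)^5$. For $\ell\in\mathbb{Z}^{+}$ and an integer $n\ge 0$, the harmonic number of order $\ell$ is $H_n^{(\ell)}=\sum_{k=1}^n \frac{1}{k^{\ell}}$ (so $H_0^{(\ell)}=0$). $\zeta(s)=\sum_{k=1}^\infty k^{-s}$ is the Riemann zeta function for $\Re(s)>1$. *)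

theory Defs
  imports "HOL-Analysis.Analysis"
begin

definition gen_harm :: "nat \<Rightarrow> nat \<Rightarrow> 'a :: real_normed_field" where
  "gen_harm l n = (\<Sum>k=1..n. 1 / of_nat k ^ l)"

text \<open>The Dirichlet series is indexed from 0, so the summand at \<open>k\<close> is \<open>(k+1) powr (-s)\<close>.
  The value is meaningful only for \<open>Re s > 1\<close>, where the series converges.\<close>

definition zeta :: "complex \<Rightarrow> complex" where
  "zeta s = (\<Sum>k. of_nat (Suc k) powr (-s))"

end

theory Submission
  imports Defs "HOL-Real_Asymp.Real_Asymp"
begin

text \<open>
  Write \<open>y\<^sub>j = j + 1/2\<close> and \<open>S\<^sub>m = (\<Sum>j<m. 1 / y\<^sub>j\<^sup>3)\<close>. Removing the even
  denominators from \<open>8 * H\<^bsub>2k+1\<^esub>\<^sup>(\<^sup>3\<^sup>)\<close> shows that the harmonic factor of the summand is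
  \<open>S\<^bsub>k+1\<^esub>\<close>, and that \<open>S\<^sub>m\<close> tends to \<open>7 \<zeta>(3)\<close>. So the sum to be found is
  half the square of \<open>lim S\<^sub>m\<close>.

  The identity is the coefficient of \<open>X\<close> in a one-parameter family of identities. Let
  \[ F_X(n,k) = (n+1+2k)\, T_X(n,k), \qquad
     T_X(n,k) = \frac{(-1)^n \prod_{j=1}^n (j^6 - X^2)}{(2n)!}
       \prod_{j<k} y_j (y_j^3 + X) \prod_{j \le n+k} \frac{1}{y_j (y_j^3 - X)} . \]
  These are the terms of the well-poised series with \<open>a = n + 1\<close> and the upper parameters
  \<open>1/2\<close>, \<open>1/2 + x\<close>, \<open>1/2 + \<omega> x\<close>, \<open>1/2 + \<omega>\<^sup>2 x\<close>, where
  \<open>\<omega>\<close> is a primitive cube root of unity and \<open>X = x\<^sup>3\<close>.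
  There is a rational function \<open>R\<^sub>X\<close> such that \<open>G\<^sub>X = R\<^sub>X T\<^sub>X\<close> satisfies
  \[ F_X(n,k) - F_X(n+1,k) = G_X(n,k) - G_X(n,k+1), \]
  namely \<open>R\<^sub>X(n,k) = r(n,k) + X / (2 (n+1) (2n+1))\<close> with \<open>r\<close> the function
  \<open>wz_cert\<close> below.
  Hence the sums of \<open>F\<^sub>X(0,k)\<close> over \<open>k\<close> and of \<open>G\<^sub>X(n,0)\<close> over \<open>n\<close>
  agree. The first one is elementary: the cube roots of unity make \<open>X F\<^sub>X(0,k)\<close> the difference
  of two consecutive products \<open>(\<Prod>j<k. (y\<^sub>j\<^sup>3 + X) / (y\<^sub>j\<^sup>3 - X))\<close>. The second
  one is the rapidly convergent series with the ratio \<open>-1/4\<close>.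

  To first order in \<open>X\<close>, \<open>T\<^sub>X(n,k)\<close> is
  \<open>T\<^sub>0(n,k) (1 + X (S\<^sub>k + S\<^bsub>n+k+1\<^esub>))\<close>, since the
  factors \<open>j\<^sup>6 - X\<^sup>2\<close> vary only with \<open>X\<^sup>2\<close>. The functions \<open>wz_F\<close> and \<open>wz_G\<close>
  are the resulting coefficients of \<open>X\<close> in \<open>F\<^sub>X\<close> and \<open>G\<^sub>X\<close>. They satisfy the
  same difference equation (\<open>wz_pair\<close>), so the argument can be carried out for
  these real coefficients directly. Moreover \<open>wz_F 0 k\<close> telescopes to \<open>2 S\<^sub>K\<^sup>2\<close> (\<open>wz_F_0\<close>), and
  \<open>wz_G n 0\<close> is four times the summand of the theorem (\<open>wz_G_0\<close>). Summing the difference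
  equation over a rectangle (\<open>wz_rectangle\<close>) and letting first its width in \<open>k\<close>, then its
  height in \<open>n\<close> tend to infinity gives \<open>(\<Sum>n. wz_G n 0) = 2 (lim S\<^sub>m)\<^sup>2\<close>; the two
  far sides vanish in the limit because \<open>T\<^sub>0(n,k)\<close> is at most
  \<open>2\<^sup>-\<^sup>n y\<^sub>k\<^sup>-\<^sup>4\<close> in absolute value (\<open>wz_base_bound\<close>).
\<close>

section \<open>Cubic sums over the half-integers and \<open>\<zeta>(3)\<close>\<close>

definition half_cube_sum :: "nat \<Rightarrow> real" where
  "half_cube_sum m = (\<Sum>j<m. 1 / (real j + 1/2) ^ 3)"

lemma half_cube_sum_0 [simp]: "half_cube_sum 0 = 0"
  by (simp add: half_cube_sum_def)

lemma half_cube_sum_Suc: "half_cube_sum (Suc m) = half_cube_sum m + 1 / (real m + 1/2) ^ 3"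
  by (simp add: half_cube_sum_def)

lemma half_cube_sum_nonneg: "half_cube_sum m \<ge> 0"
  unfolding half_cube_sum_def by (intro sum_nonneg) simp

lemma incseq_half_cube_sum: "incseq half_cube_sum"
  by (rule incseq_SucI) (simp add: half_cube_sum_Suc)

lemma gen_harm_Suc: "gen_harm l (Suc n) = gen_harm l n + 1 / of_nat (Suc n) ^ l"
  by (simp add: gen_harm_def)

lemma of_real_gen_harm: "of_real (gen_harm l n) = gen_harm l n"
  by (simp add: gen_harm_def)

text \<open>
  The left side is \<open>8\<close> times the sum of \<open>1 / i\<^sup>3\<close> over odd \<open>i \<le> 2k+1\<close>, and the even
  \<open>i\<close> contribute exactly \<open>H\<^sub>k\<^sup>(\<^sup>3\<^sup>)\<close> to \<open>8 H\<^bsub>2k+1\<^esub>\<^sup>(\<^sup>3\<^sup>)\<close>.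
\<close>

lemma half_cube_sum_eq_gen_harm:
  "half_cube_sum (Suc k) = 8 * gen_harm 3 (2 * k + 1) - gen_harm 3 k"
proof (induction k)
  case 0
  show ?case by (simp add: half_cube_sum_def gen_harm_def power3_eq_cube)
next
  case (Suc k)
  have eq: "gen_harm 3 (2 * Suc k + 1) =
      (gen_harm 3 (2 * k + 1) + 1 / (2 * real k + 2) ^ 3 + 1 / (2 * real k + 3) ^ 3 :: real)"
    by (simp add: gen_harm_Suc add_ac)
  have even_part: "8 / (2 * real k + 2) ^ 3 = 1 / (real k + 1) ^ 3"
  proof -
    have "(2 * real k + 2) ^ 3 = (2 * (real k + 1)) ^ 3" by simp
    then show ?thesis by (simp only: power_mult_distrib) simp
  qed
  have odd_part: "8 / (2 * real k + 3) ^ 3 = 1 / (real (Suc k) + 1/2) ^ 3"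
  proof -
    have "(2 * real k + 3) ^ 3 = (2 * (real (Suc k) + 1/2)) ^ 3" by (simp add: add_ac)
    then show ?thesis by (simp only: power_mult_distrib) simp
  qed
  have "gen_harm 3 (Suc k) = (gen_harm 3 k + 1 / (real k + 1) ^ 3 :: real)"
    by (simp add: gen_harm_Suc add_ac)
  with Suc.IH eq even_part odd_part show ?case
    by (subst half_cube_sum_Suc) simp
qed

lemma gen_harm_3_tendsto_zeta: "(\<lambda>n. gen_harm 3 n :: complex) \<longlonglongrightarrow> zeta 3"
proof -
  have term_eq: "of_nat (Suc k) powr (-3) = (1 / of_nat (Suc k) ^ 3 :: complex)" for k
  proof -
    have "of_nat (Suc k) powr (-3 :: complex) = inverse (of_nat (Suc k) powr of_nat 3)"
      by (simp add: powr_minus)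
    also have "of_nat (Suc k) powr (of_nat 3 :: complex) = of_nat (Suc k) ^ 3"
      by (subst powr_nat) (simp del: of_nat_Suc)
    finally show ?thesis by (simp add: field_simps)
  qed
  have "summable (\<lambda>k. inverse (of_nat (Suc k) ^ 3 :: complex))"
    by (subst summable_Suc_iff) (rule inverse_power_summable, simp)
  then have "(\<lambda>k. 1 / of_nat (Suc k) ^ 3 :: complex) sums zeta 3"
    unfolding zeta_def term_eq by (simp add: summable_sums inverse_eq_divide del: of_nat_Suc)
  moreover have "(\<Sum>k<n. 1 / of_nat (Suc k) ^ 3) = (gen_harm 3 n :: complex)" for n
    by (induction n) (simp_all add: gen_harm_Suc, simp add: gen_harm_def)
  ultimately show ?thesis
    by (simp add: sums_def)
qed

lemma half_cube_sum_tendsto: "(\<lambda>m. of_real (half_cube_sum m)) \<longlonglongrightarrow> 7 * zeta 3"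
proof -
  have sub: "filterlim (\<lambda>k::nat. 2 * k + 1) at_top at_top"
    by (rule filterlim_subseq) (simp add: strict_mono_def)
  have "(\<lambda>k. 8 * gen_harm 3 (2 * k + 1) - gen_harm 3 k) \<longlonglongrightarrow> 8 * zeta 3 - zeta 3"
    by (intro tendsto_intros gen_harm_3_tendsto_zeta
          filterlim_compose [OF gen_harm_3_tendsto_zeta sub])
  also have "(\<lambda>k. 8 * gen_harm 3 (2 * k + 1) - gen_harm 3 k :: complex) =
      (\<lambda>k. of_real (half_cube_sum (Suc k)))"
    by (simp add: half_cube_sum_eq_gen_harm of_real_gen_harm)
  finally show ?thesis
    by (subst (asm) filterlim_sequentially_Suc) simp
qed

section \<open>The Wilf--Zeilberger pair\<close>

text \<open>
  \<open>T\<^sub>0(n,k)\<close>; the products of the \<open>y\<^sub>j\<close> are written as Pochhammer symbols at \<open>1/2\<close>.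
\<close>

definition wz_base :: "nat \<Rightarrow> nat \<Rightarrow> real" where
  "wz_base n k = (-1) ^ n * fact n ^ 6 / fact (2 * n) *
     (pochhammer (1/2) k / pochhammer (1/2) (n + k + 1)) ^ 4"

text \<open>
  The coefficients of \<open>X\<close>: a factor of \<open>T\<^sub>X\<close> of the form \<open>y\<^sub>j\<^sup>3 + X\<close> in the numerator or
  \<open>y\<^sub>j\<^sup>3 - X\<close> in the denominator contributes \<open>1 / y\<^sub>j\<^sup>3\<close> to the logarithmic derivative at
  \<open>X = 0\<close>.
\<close>

definition wz_F :: "nat \<Rightarrow> nat \<Rightarrow> real" where
  "wz_F n k = (real n + 1 + 2 * real k) * wz_base n k *
     (half_cube_sum k + half_cube_sum (n + k + 1))"

text \<open>
  The part of \<open>R\<^sub>X\<close> that is free of \<open>X\<close>. The leading terms in \<open>k\<close> of the equation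
  in \<open>wz_cert_order_0\<close> match for a quadratic polynomial in \<open>k\<close>; its coefficients then follow
  from a linear system over the rational functions of \<open>n\<close>.
\<close>

definition wz_cert :: "real \<Rightarrow> real \<Rightarrow> real" where
  "wz_cert n k = (10 * n^2 + 14 * n + 5 + (12 * n + 8) * k + 4 * k^2) / (4 * (2 * n + 1))"

definition wz_G :: "nat \<Rightarrow> nat \<Rightarrow> real" where
  "wz_G n k = wz_base n k *
     (wz_cert n k * (half_cube_sum k + half_cube_sum (n + k + 1))
        + 1 / (2 * (real n + 1) * (2 * real n + 1)))"

lemma pochhammer_half_pos: "pochhammer (1/2 :: real) k > 0"
  by (rule pochhammer_pos) simp

lemma pochhammer_half_quotient:
  "pochhammer (1/2 :: real) k / pochhammer (1/2) (k + 1) = 1 / (real k + 1/2)"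
  using pochhammer_half_pos [of k] by (simp add: pochhammer_Suc add.commute)

lemma wz_base_Suc_left:
  "wz_base (Suc n) k = - wz_base n k * (real n + 1) ^ 6 /
     ((2 * real n + 1) * (2 * real n + 2) * (real n + real k + 3/2) ^ 4)"
proof -
  have *: "pochhammer (1/2 :: real) (Suc n + k + 1) =
      pochhammer (1/2) (n + k + 1) * (real n + real k + 3/2)"
    by (simp add: pochhammer_Suc algebra_simps)
  have **: "(fact (2 * Suc n) :: real) = (2 * real n + 1) * (2 * real n + 2) * fact (2 * n)"
    by (simp add: algebra_simps)
  have ***: "(fact (Suc n) :: real) = (real n + 1) * fact n"
    by (simp add: algebra_simps)
  show ?thesis
    unfolding wz_base_def * ** ***
    by (simp only: power_mult_distrib power_divide power_Suc) (simp add: field_simps)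
qed

lemma wz_base_Suc_right:
  "wz_base n (Suc k) = wz_base n k * (real k + 1/2) ^ 4 / (real n + real k + 3/2) ^ 4"
proof -
  have "pochhammer (1/2 :: real) (n + Suc k + 1) =
      pochhammer (1/2) (n + k + 1) * (real n + real k + 3/2)"
    by (simp add: pochhammer_Suc algebra_simps)
  moreover have "pochhammer (1/2 :: real) (Suc k) = pochhammer (1/2) k * (real k + 1/2)"
    by (simp add: pochhammer_Suc algebra_simps)
  ultimately show ?thesis
    unfolding wz_base_def by (simp add: power_mult_distrib power_divide)
qed

text \<open>
  Divide the difference equation for \<open>F\<^sub>X\<close> and \<open>G\<^sub>X\<close> by \<open>T\<^sub>X(n,k)\<close> and multiply by
  \<open>v (v\<^sup>3 - X)\<close>, where \<open>v = n + k + 3/2\<close>. What remains is rational in \<open>n\<close> and \<open>k\<close>.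
  This is its constant term in \<open>X\<close>.
\<close>

lemma wz_cert_order_0:
  fixes n k :: real
  assumes "n \<ge> 0"
  shows "(n + 1 + 2 * k) * (n + k + 3/2) ^ 4
           + (n + 1) ^ 6 / ((2 * n + 1) * (2 * n + 2)) * (n + 2 + 2 * k)
         = wz_cert n k * (n + k + 3/2) ^ 4 - wz_cert n (k + 1) * (k + 1/2) ^ 4"
proof -
  have *: "(n + 1) ^ 6 / ((2 * n + 1) * (2 * n + 2)) = 2 * (n + 1) ^ 5 / (4 * (2 * n + 1))"
    using assms by (simp add: divide_simps) algebra
  show ?thesis
    unfolding wz_cert_def * using assms by (simp add: divide_simps) algebra
qed

text \<open>
  This is what the coefficient of \<open>X\<close> in the difference equation requires in addition: it
  balances the increments \<open>1 / (k + 1/2)\<^sup>3\<close> and \<open>1 / v\<^sup>3\<close> that \<open>S\<^sub>k\<close> and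
  \<open>S\<^bsub>n+k+1\<^esub>\<close> receive when \<open>n\<close> or \<open>k\<close> grows by one against the term
  \<open>X / (2 (n+1) (2n+1))\<close> of \<open>R\<^sub>X\<close>. Denominators are cleared by a factor \<open>v\<^sup>7\<close>.
\<close>

lemma wz_cert_order_1:
  fixes n k :: real
  assumes "n \<ge> 0"
  shows "(n + 1) ^ 6 / ((2 * n + 1) * (2 * n + 2)) * (n + 2 + 2 * k)
         = ((n + k + 3/2) ^ 7 - (k + 1/2) ^ 4 * (n + k + 3/2) ^ 3) / (2 * (n + 1) * (2 * n + 1))
           - wz_cert n (k + 1) * ((k + 1/2) * (n + k + 3/2) ^ 3 + (k + 1/2) ^ 4)"
  (is "?l = ?r")
proof -
  have "?l * (4 * (n + 1) * (2 * n + 1)) = 2 * (n + 1) ^ 6 * (n + 2 + 2 * k)"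
    using assms by (simp add: divide_simps)
  moreover have "?r * (4 * (n + 1) * (2 * n + 1)) =
      2 * ((n + k + 3/2) ^ 7 - (k + 1/2) ^ 4 * (n + k + 3/2) ^ 3)
      - (n + 1) * (10 * n^2 + 14 * n + 5 + (12 * n + 8) * (k + 1) + 4 * (k + 1)^2) *
        ((k + 1/2) * (n + k + 3/2) ^ 3 + (k + 1/2) ^ 4)"
    unfolding wz_cert_def using assms
    by (simp add: divide_simps) (simp add: algebra_simps)
  moreover have "2 * (n + 1) ^ 6 * (n + 2 + 2 * k) =
      2 * ((n + k + 3/2) ^ 7 - (k + 1/2) ^ 4 * (n + k + 3/2) ^ 3)
      - (n + 1) * (10 * n^2 + 14 * n + 5 + (12 * n + 8) * (k + 1) + 4 * (k + 1)^2) *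
        ((k + 1/2) * (n + k + 3/2) ^ 3 + (k + 1/2) ^ 4)"
    by algebra
  ultimately have "?l * (4 * (n + 1) * (2 * n + 1)) = ?r * (4 * (n + 1) * (2 * n + 1))"
    by (simp only:)
  then show ?thesis
    by (rule mult_right_cancel [THEN iffD1, rotated]) (use assms in simp)
qed

text \<open>
  All four terms are \<open>wz_base n k\<close> times a polynomial of degree one in
  \<open>A = S\<^sub>k + S\<^bsub>n+k+1\<^esub>\<close>. The coefficients of \<open>A\<close> agree by
  \<open>wz_cert_order_0\<close> and the constant terms by \<open>wz_cert_order_1\<close>.
\<close>

lemma wz_pair: "wz_F n k - wz_F (Suc n) k = wz_G n k - wz_G n (Suc k)"
proof -
  define B where "B = wz_base n k"
  define A where "A = half_cube_sum k + half_cube_sum (n + k + 1)"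
  define s where "s = real k + 1/2"
  define v where "v = real n + real k + 3/2"
  define r where "r = (real n + 1) ^ 6 / ((2 * real n + 1) * (2 * real n + 2))"
  define q where "q = wz_cert n k"
  define q' where "q' = wz_cert n (real k + 1)"
  define e where "e = 1 / (2 * (real n + 1) * (2 * real n + 1))"
  have pos: "s > 0" "v > 0" by (simp_all add: s_def v_def)
  have order_0: "r * (real n + 2 + 2 * real k) = q * v ^ 4 - q' * s ^ 4 - (real n + 1 + 2 * real k) * v ^ 4"
    using wz_cert_order_0 [of "real n" "real k"] unfolding r_def q_def q'_def s_def v_def
    by (simp add: algebra_simps)
  have order_1: "r * (real n + 2 + 2 * real k) = e * (v ^ 7 - s ^ 4 * v ^ 3) - q' * (s * v ^ 3 + s ^ 4)"
    using wz_cert_order_1 [of "real n" "real k"] by (simp add: r_def q'_def s_def v_def e_def)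
  have half_cube_sum_shift: "half_cube_sum (Suc n + k + 1) = half_cube_sum (n + k + 1) + 1 / v ^ 3"
    "half_cube_sum (n + Suc k + 1) = half_cube_sum (n + k + 1) + 1 / v ^ 3"
    by (simp_all add: half_cube_sum_Suc v_def algebra_simps)
  have F_n: "wz_F n k = B * ((real n + 1 + 2 * real k) * A)"
    by (simp add: wz_F_def B_def A_def)
  have base: "wz_base (Suc n) k = - B * r / v ^ 4"
    by (simp add: wz_base_Suc_left B_def r_def v_def)
  have F_Suc: "wz_F (Suc n) k = - B * (r * (real n + 2 + 2 * real k) / v ^ 4 * (A + 1 / v ^ 3))"
    unfolding wz_F_def base half_cube_sum_shift by (simp add: A_def add_ac)
  have G_k: "wz_G n k = B * (q * A + e)"
    by (simp add: wz_G_def B_def A_def q_def e_def)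
  have G_Suc: "wz_G n (Suc k) = B * (s ^ 4 / v ^ 4 * (q' * (A + 1 / s ^ 3 + 1 / v ^ 3) + e))"
    unfolding wz_G_def half_cube_sum_shift wz_base_Suc_right half_cube_sum_Suc
    by (simp add: A_def B_def q'_def e_def s_def v_def add_ac)
  have "(real n + 1 + 2 * real k) * A + r * (real n + 2 + 2 * real k) / v ^ 4 * A =
      q * A - s ^ 4 / v ^ 4 * (q' * A)"
    unfolding order_0 using pos by (simp add: field_simps)
  moreover have "r * (real n + 2 + 2 * real k) / v ^ 4 * (1 / v ^ 3) =
      e - s ^ 4 / v ^ 4 * (q' * (1 / s ^ 3 + 1 / v ^ 3) + e)"
    unfolding order_1 using pos by (simp add: divide_simps) algebra
  ultimately have "(real n + 1 + 2 * real k) * A + r * (real n + 2 + 2 * real k) / v ^ 4 * (A + 1 / v ^ 3) =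
      q * A + e - s ^ 4 / v ^ 4 * (q' * (A + 1 / s ^ 3 + 1 / v ^ 3) + e)"
    by (simp only: distrib_left add.assoc)
  then show ?thesis
    unfolding F_n F_Suc G_k G_Suc by (metis minus_mult_left diff_minus_eq_add distrib_left right_diff_distrib)
qed

section \<open>Estimates\<close>

text \<open>
  One factor \<open>(n!)\<^sup>2 / (2n)!\<close> is the inverse of a central binomial coefficient and provides the
  decay in \<open>n\<close>. The other \<open>(n!)\<^sup>4\<close> is absorbed by the four products
  \<open>(\<Prod>i\<le>n. k + i + 1/2)\<close>, each of which is at least \<open>(k + 1/2) n!\<close>.
\<close>

lemma wz_base_bound: "\<bar>wz_base n k\<bar> \<le> 1 / 2 ^ n / (real k + 1/2) ^ 4"
proof -
  have central: "fact n ^ 2 / fact (2 * n) \<le> (1 / 2 ^ n :: real)"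
  proof (induction n)
    case (Suc n)
    have "fact (Suc n) ^ 2 / fact (2 * Suc n) =
        (fact n ^ 2 / fact (2 * n)) * ((real n + 1) / (2 * (2 * real n + 1)))"
      by (simp add: divide_simps) algebra
    also have "\<dots> \<le> (1 / 2 ^ n) * (1 / 2)"
      by (intro mult_mono Suc.IH) (simp_all add: field_simps)
    finally show ?case by simp
  qed simp
  have quotient: "fact n * (pochhammer (1/2) k / pochhammer (1/2) (n + k + 1)) \<le> 1 / (real k + 1/2)"
  proof (induction n)
    case 0
    show ?case
      using pochhammer_half_quotient [of k] by simp
  next
    case (Suc n)
    have "fact (Suc n) * (pochhammer (1/2) k / pochhammer (1/2) (Suc n + k + 1)) =
        fact n * (pochhammer (1/2) k / pochhammer (1/2) (n + k + 1)) *
          ((real n + 1) / (real n + real k + 3/2))"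
      by (simp add: pochhammer_Suc field_simps)
    also have "\<dots> \<le> 1 / (real k + 1/2) * 1"
      using pochhammer_half_pos
      by (intro mult_mono Suc.IH) (simp_all add: less_imp_le)
    finally show ?case by simp
  qed
  have nonneg: "fact n * (pochhammer (1/2 :: real) k / pochhammer (1/2) (n + k + 1)) \<ge> 0"
    using pochhammer_half_pos by (simp add: less_imp_le)
  have "\<bar>wz_base n k\<bar> = (fact n ^ 2 / fact (2 * n)) *
      (fact n * (pochhammer (1/2) k / pochhammer (1/2) (n + k + 1))) ^ 4"
    using pochhammer_half_pos 
    by (simp add: wz_base_def abs_mult power_abs power_mult_distrib power_divide
        flip: power_add)
  also have "\<dots> \<le> (1 / 2 ^ n) * (1 / (real k + 1/2)) ^ 4"
    using nonneg by (intro mult_mono power_mono central quotient) simp_all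
  finally show ?thesis by (simp add: power_divide)
qed

text \<open>
  The dependence on \<open>k\<close> is again a term of \<open>half_cube_sum\<close>, so that each row sum of \<open>wz_F\<close>
  is bounded uniformly in its length.
\<close>

lemma wz_F_bound:
  assumes "\<And>m. half_cube_sum m \<le> M"
  shows "\<bar>wz_F n k\<bar> \<le> 4 * M * (real n + 1) / 2 ^ n * (1 / (real k + 1/2) ^ 3)"
proof -
  have "\<bar>wz_F n k\<bar> = \<bar>wz_base n k\<bar> * (real n + 1 + 2 * real k) *
      (half_cube_sum k + half_cube_sum (n + k + 1))"
    by (simp add: wz_F_def abs_mult half_cube_sum_nonneg add_nonneg_nonneg)
  also have "\<dots> \<le> 1 / 2 ^ n / (real k + 1/2) ^ 4 * ((real n + 1) * (2 * (real k + 1/2))) * (M + M)"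
    by (intro mult_mono wz_base_bound add_mono assms)
       (simp_all add: half_cube_sum_nonneg add_nonneg_nonneg algebra_simps)
  also have "\<dots> = 4 * M * (real n + 1) / 2 ^ n * ((real k + 1/2) / (real k + 1/2) ^ 4)"
    by (simp add: field_simps)
  also have "(real k + 1/2) / (real k + 1/2) ^ 4 = 1 / (real k + 1/2) ^ 3"
    by (simp add: divide_simps) algebra
  finally show ?thesis .
qed

lemma wz_G_tendsto_0:
  assumes "\<And>m. half_cube_sum m \<le> M"
  shows "wz_G n \<longlonglongrightarrow> 0"
proof (rule Lim_null_comparison)
  let ?e = "1 / (2 * (real n + 1) * (2 * real n + 1))"
  let ?b = "\<lambda>k::nat. 1 / 2 ^ n / (real k + 1/2) ^ 4 * (wz_cert n k * (M + M) + ?e)"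
  have cert_nonneg: "wz_cert n k \<ge> 0" for k :: nat
    by (simp add: wz_cert_def)
  have "\<bar>wz_G n k\<bar> \<le> ?b k" for k
  proof -
    have "\<bar>wz_G n k\<bar> = \<bar>wz_base n k\<bar> *
        (wz_cert n k * (half_cube_sum k + half_cube_sum (n + k + 1)) + ?e)"
      by (simp add: wz_G_def abs_mult half_cube_sum_nonneg add_nonneg_nonneg cert_nonneg)
    also have "\<dots> \<le> ?b k"
      by (intro mult_mono wz_base_bound add_mono assms order_refl)
         (simp_all add: half_cube_sum_nonneg add_nonneg_nonneg cert_nonneg)
    finally show ?thesis .
  qed
  then show "\<forall>\<^sub>F k in sequentially. norm (wz_G n k) \<le> ?b k"
    by simp
  show "?b \<longlonglongrightarrow> 0"
    unfolding wz_cert_def by real_asymp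
qed

section \<open>Summation\<close>

lemma wz_F_0: "wz_F 0 k = 2 * half_cube_sum (Suc k) ^ 2 - 2 * half_cube_sum k ^ 2"
proof -
  define d where "d = 1 / (real k + 1/2) ^ 3"
  have "wz_base 0 k = (1 / (real k + 1/2)) ^ 4"
    unfolding pochhammer_half_quotient [symmetric] by (simp add: wz_base_def)
  then have "(1 + 2 * real k) * wz_base 0 k = 2 * ((real k + 1/2) / (real k + 1/2) ^ 4)"
    by (simp add: power_divide distrib_left)
  also have "(real k + 1/2) / (real k + 1/2) ^ 4 = 1 / (real k + 1/2) ^ 3"
    by (simp add: divide_simps) algebra
  finally have weight: "(1 + 2 * real k) * wz_base 0 k = 2 * d"
    by (simp add: d_def)
  have "half_cube_sum (Suc k) = half_cube_sum k + d"
    by (simp add: half_cube_sum_Suc d_def)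
  then show ?thesis
    by (simp add: wz_F_def weight) (simp add: power2_eq_square algebra_simps)
qed

lemma wz_rectangle:
  "(\<Sum>k<K. wz_F 0 k) - (\<Sum>k<K. wz_F N k) = (\<Sum>n<N. wz_G n 0) - (\<Sum>n<N. wz_G n K)"
proof -
  have "(\<Sum>k<K. wz_F n k) - (\<Sum>k<K. wz_F (Suc n) k) = wz_G n 0 - wz_G n K" for n
    by (simp add: wz_pair sum_lessThan_telescope' flip: sum_subtractf)
  then have "(\<Sum>n<N. wz_G n 0 - wz_G n K) = (\<Sum>k<K. wz_F 0 k) - (\<Sum>k<K. wz_F N k)"
    using sum_lessThan_telescope' [of "\<lambda>n. \<Sum>k<K. wz_F n k" N] by simp
  then show ?thesis by (simp add: sum_subtractf)
qed

text \<open>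
  In \<open>wz_rectangle\<close>, with \<open>N\<close> fixed, the side \<open>wz_G n K\<close> disappears as \<open>K\<close> tends to
  infinity; the side \<open>wz_F N k\<close> leaves an error that is bounded by a multiple of
  \<open>(N + 1) / 2\<^sup>N\<close> for all \<open>K\<close>.
\<close>

lemma wz_G_column_sums:
  assumes lim: "half_cube_sum \<longlonglongrightarrow> M"
  shows "(\<lambda>n. wz_G n 0) sums (2 * M ^ 2)"
proof -
  have le: "half_cube_sum m \<le> M" for m
    by (rule incseq_le [OF incseq_half_cube_sum lim])
  have M: "M \<ge> 0" using le [of 0] by simp
  have F_row: "\<bar>\<Sum>k<K. wz_F N k\<bar> \<le> 4 * M * (real N + 1) / 2 ^ N * M" for N K
  proof -
    have "\<bar>\<Sum>k<K. wz_F N k\<bar> \<le> (\<Sum>k<K. 4 * M * (real N + 1) / 2 ^ N * (1 / (real k + 1/2) ^ 3))"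
      by (rule order_trans [OF sum_abs sum_mono]) (rule wz_F_bound [OF le])
    also have "\<dots> = 4 * M * (real N + 1) / 2 ^ N * half_cube_sum K"
      by (simp only: half_cube_sum_def sum_distrib_left)
    also have "\<dots> \<le> 4 * M * (real N + 1) / 2 ^ N * M"
      by (intro mult_left_mono le) (simp add: M)
    finally show ?thesis .
  qed
  have F_0: "(\<Sum>k<K. wz_F 0 k) = 2 * half_cube_sum K ^ 2" for K
    using sum_lessThan_telescope [of "\<lambda>k. 2 * half_cube_sum k ^ 2" K] by (simp add: wz_F_0)
  have bound: "\<bar>(\<Sum>n<N. wz_G n 0) - 2 * M ^ 2\<bar> \<le> 4 * M * (real N + 1) / 2 ^ N * M" for N
  proof (rule tendsto_upperbound)
    show "(\<lambda>K. \<bar>(\<Sum>n<N. wz_G n 0) - (\<Sum>n<N. wz_G n K) - 2 * half_cube_sum K ^ 2\<bar>)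
        \<longlonglongrightarrow> \<bar>(\<Sum>n<N. wz_G n 0) - 2 * M ^ 2\<bar>"
      by (rule tendsto_eq_intros lim wz_G_tendsto_0 le refl | simp)+
    have "\<bar>(\<Sum>n<N. wz_G n 0) - (\<Sum>n<N. wz_G n K) - 2 * half_cube_sum K ^ 2\<bar>
        \<le> 4 * M * (real N + 1) / 2 ^ N * M" for K
      using F_row [where N = N and K = K] wz_rectangle [of K N] F_0 [of K] by simp
    then show "\<forall>\<^sub>F K in sequentially.
        \<bar>(\<Sum>n<N. wz_G n 0) - (\<Sum>n<N. wz_G n K) - 2 * half_cube_sum K ^ 2\<bar>
        \<le> 4 * M * (real N + 1) / 2 ^ N * M"
      by simp
  qed simp
  have "(\<lambda>N. (\<Sum>n<N. wz_G n 0) - 2 * M ^ 2) \<longlonglongrightarrow> 0"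
  proof (rule Lim_null_comparison)
    show "\<forall>\<^sub>F N in sequentially. norm ((\<Sum>n<N. wz_G n 0) - 2 * M ^ 2)
        \<le> 4 * M * (real N + 1) / 2 ^ N * M"
      using bound by simp
    show "(\<lambda>N. 4 * M * (real N + 1) / 2 ^ N * M) \<longlonglongrightarrow> 0"
      by real_asymp
  qed
  then show ?thesis
    unfolding sums_def by (simp add: LIM_zero_iff)
qed

text \<open>
  The base \<open>1/4\<close> and one of the five quotients \<open>n! / (3/2)\<^sub>n\<close> come from the duplication
  formula \<open>(2n)! = 4\<^sup>n (1/2)\<^sub>n n!\<close>, the other four from the fourth power in \<open>wz_base\<close>.
\<close>

lemma wz_G_0:
  "wz_G n 0 = 4 * ((- 1 / 4) ^ n * (pochhammer 1 n ^ 5 / pochhammer (3 / 2) n ^ 5) *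
     ((10 * real n ^ 2 + 14 * real n + 5) * half_cube_sum (Suc n) + 2 / (real n + 1)))"
proof -
  let ?p = "pochhammer (3 / 2 :: real) n"
  have p: "?p > 0" by (rule pochhammer_pos) simp
  have half_Suc: "pochhammer (1/2 :: real) (n + 0 + 1) = ?p / 2"
    by (simp add: pochhammer_rec)
  have half: "pochhammer (1/2 :: real) n = ?p / (2 * real n + 1)"
    using half_Suc by (simp add: pochhammer_Suc field_simps)
  have fact: "(fact (2 * n) :: real) = 4 ^ n * (?p / (2 * real n + 1)) * fact n"
    by (simp add: fact_double power_mult half)
  have power: "(- 1 / 4 :: real) ^ n = (- 1) ^ n / 4 ^ n"
    by (rule power_divide)
  have base: "wz_base n 0 =
      16 * (2 * real n + 1) * ((- 1 / 4) ^ n * (pochhammer 1 n ^ 5 / ?p ^ 5))"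
    unfolding wz_base_def half_Suc half fact power pochhammer_fact [symmetric] using p
    by (simp add: power_divide divide_simps) (simp add: eval_nat_numeral)
  show ?thesis
    unfolding wz_G_def base wz_cert_def by (simp add: divide_simps) (simp add: algebra_simps)
qed

theorem theorem1p2:
  shows "(\<lambda>k::nat. (- 1 / 4 :: complex) ^ k * (pochhammer 1 k ^ 5 / pochhammer (3 / 2) k ^ 5) *
            ((10 * of_nat k ^ 2 + 14 * of_nat k + 5) *
               (8 * gen_harm 3 (2 * k + 1) - gen_harm 3 k) + 2 / (of_nat k + 1)))
         sums (49 * zeta 3 ^ 2 / 2)"
proof -
  have "half_cube_sum \<longlonglongrightarrow> Re (7 * zeta 3)"
    using tendsto_Re [OF half_cube_sum_tendsto] by simp
  then obtain M where lim: "half_cube_sum \<longlonglongrightarrow> M" ..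
  have M: "of_real M = 7 * zeta 3"
    using tendsto_of_real [OF lim] half_cube_sum_tendsto by (rule LIMSEQ_unique)
  have "(\<lambda>n. of_real (wz_G n 0 / 4) :: complex) sums of_real (2 * M ^ 2 / 4)"
    by (intro sums_of_real sums_divide wz_G_column_sums lim)
  also have "(of_real (2 * M ^ 2 / 4) :: complex) = 49 * zeta 3 ^ 2 / 2"
    by (simp add: M power_mult_distrib)
  also have "(\<lambda>n. of_real (wz_G n 0 / 4) :: complex) =
     (\<lambda>k::nat. (- 1 / 4 :: complex) ^ k * (pochhammer 1 k ^ 5 / pochhammer (3 / 2) k ^ 5) *
            ((10 * of_nat k ^ 2 + 14 * of_nat k + 5) *
               (8 * gen_harm 3 (2 * k + 1) - gen_harm 3 k) + 2 / (of_nat k + 1)))"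
    by (simp add: wz_G_0 half_cube_sum_eq_gen_harm of_real_gen_harm flip: pochhammer_of_real)
  finally show ?thesis .
qed

end
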